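(* Let $\ell$ and $n$ be positive integers and let $\mathcal F\subset 2^{[n]}$ be a $4\ell^2$-wise $\ell$-divisible set family. Then (1) $|\mathcal F|\le 2^{\lfloor n/\ell\rfloor}$; (2) if $|\mathcal F|>2^{\lfloor n/\ell\rfloor-1}$, then $\mathcal F$ is contained in an atomic family with atoms of size $\ell$, i.e. there exist pairwise disjoint subsets $B_1,\dots,B_a\subset[n]$, each of cardinality $\ell$, such that every member of $\mathcal F$ is a union of some of the $B_i$.
   Context: A family $\mathcal F\subset 2^{[n]}$ is called $k$-wise $\ell$-divisible if $|A_1\cap\cdots\cap A_k|$ is divisible by $\ell$ for all (not necessarily distinct) $A_1,\dots,A_k\in\mathcal F$. An atomic family is the family of all unions (including the empty union) of some pairwise disjoint subsets of $[n]$, called its atoms. *)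

theory Defs
  imports Complex_Main
begin

text \<open>The members \<open>A 1, \<dots>, A k\<close> need not be distinct. Only \<open>k \<ge> 1\<close> is meaningful: for
  \<open>k = 0\<close> the intersection below is \<open>UNIV\<close>.\<close>

definition kwise_divisible :: "nat \<Rightarrow> nat \<Rightarrow> 'a set set \<Rightarrow> bool" where
  "kwise_divisible k l F \<longleftrightarrow>
     (\<forall>A :: nat \<Rightarrow> 'a set. (\<forall>i\<in>{1..k}. A i \<in> F) \<longrightarrow> l dvd card (\<Inter>i\<in>{1..k}. A i))"

text \<open>\<open>G\<close> is the atomic family on the ground set \<open>X\<close> with set of atoms \<open>B\<close>; the
  subset \<open>{}\<close> of \<open>B\<close> contributes the empty union.\<close>

definition atomic_family :: "'a set \<Rightarrow> 'a set set \<Rightarrow> 'a set set \<Rightarrow> bool" where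
  "atomic_family X B G \<longleftrightarrow> B \<subseteq> Pow X \<and> pairwise disjnt B \<and> G = {\<Union>S | S. S \<subseteq> B}"

end

theory Submission
  imports Defs "HOL-Computational_Algebra.Primes"
begin

text \<open>Identify points of the ground set that lie in the same members of \<open>F\<close>, and give each class
  its size as weight. If for a prime \<open>p\<close> dividing \<open>l\<close> exactly \<open>a\<close> times some integer combination
  \<open>f\<close> of intersections of few members is nonzero modulo \<open>p\<close> at one class only, then
  summing \<open>f ^ a\<close> shows that \<open>p ^ a\<close> divides the weight of this class. So either all weights
  are divisible by \<open>l\<close>, and the classes can be cut into atoms, or some classes are bad for
  some prime. In the latter case let \<open>K = 2 l \<omega>(l)\<close>, where \<open>\<omega>(l)\<close> is the number of prime divisors
  of \<open>l\<close>. If the points bad for \<open>p\<close> had rank \<open>s\<close> over the field with \<open>p\<close> elements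
  and were fewer than \<open>K s\<close>, then one of them could be separated from the others by a product
  of \<open>2 K\<close> linear forms. Hence \<open>F\<close> has at most \<open>2 ^ s\<close> traces on them, with \<open>s\<close> so small that
  bad points cost at least one factor of 2 in the bound.\<close>

section \<open>Integer combinations of intersections and their weighted sums\<close>

text \<open>\<open>pol F m f\<close>: \<open>f\<close> is an integer combination of indicators of intersections of at
  least one and at most \<open>m\<close> members of \<open>F\<close>.\<close>

inductive pol :: "'a set set \<Rightarrow> nat \<Rightarrow> ('a \<Rightarrow> int) \<Rightarrow> bool" for F where
  ind: "A \<in> F \<Longrightarrow> pol F 1 (\<lambda>x. of_bool (x \<in> A))"
| up: "pol F m f \<Longrightarrow> pol F (Suc m) f"
| add: "pol F m f \<Longrightarrow> pol F m g \<Longrightarrow> pol F m (\<lambda>x. f x + g x)"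
| scale: "pol F m f \<Longrightarrow> pol F m (\<lambda>x. c * f x)"
| mult: "pol F m f \<Longrightarrow> pol F k g \<Longrightarrow> pol F (m + k) (\<lambda>x. f x * g x)"

lemma pol_pos: "pol F m f \<Longrightarrow> m > 0"
  by (induction rule: pol.induct) auto

lemma pol_mono:
  assumes "pol F m f" "m \<le> k" shows "pol F k f"
  using assms(2,1) by (induction rule: dec_induct) (auto intro: pol.up)

lemma pol_diff:
  assumes "pol F m f" "pol F m g" shows "pol F m (\<lambda>x. c * f x - d * g x)"
  using pol.add[OF pol.scale[OF assms(1), of c] pol.scale[OF assms(2), of "- d"]] by simp

lemma pol_power:
  assumes "pol F m f" "k > 0" shows "pol F (m * k) (\<lambda>x. f x ^ k)"
  using assms(2)
proof (induction k rule: nat_induct_non_zero)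
  case (Suc k)
  then show ?case using pol.mult[OF assms(1) Suc.IH] by simp
qed (use assms(1) in simp)

text \<open>Multiplying by a function of degree \<open>m\<close> uses up \<open>m\<close> of the
  \<open>m + j\<close> sets that may be intersected. The weight \<open>h\<close> is arbitrary so
  that a product can be handled one factor at a time: \<open>g x * h x\<close> becomes the new
  weight for \<open>f\<close>.\<close>

lemma dvd_sum_pol:
  assumes f: "pol F m f" and "finite P"
    and h: "\<And>Cs. length Cs = m + j \<Longrightarrow> set Cs \<subseteq> F \<Longrightarrow> l dvd (\<Sum>x\<in>P \<inter> \<Inter>(set Cs). h x)"
    and "length Cs = j" "set Cs \<subseteq> F"
  shows "l dvd (\<Sum>x\<in>P \<inter> \<Inter>(set Cs). f x * h x :: int)"
  using f h assms(4,5)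
proof (induction arbitrary: j h Cs rule: pol.induct)
  case (ind A)
  have "(\<Sum>x\<in>P \<inter> \<Inter>(set Cs). of_bool (x \<in> A) * h x) = (\<Sum>x\<in>P \<inter> \<Inter>(set (A # Cs)). h x)"
    using \<open>finite P\<close> by (intro sum.mono_neutral_cong_right) auto
  then show ?case using ind.prems(1)[of "A # Cs"] ind by simp
next
  case (up m f)
  have "l dvd (\<Sum>x\<in>P \<inter> \<Inter>(set Ds). h x)" if D: "length Ds = m + j" "set Ds \<subseteq> F" for Ds
  proof -
    \<comment> \<open>Repeating a member pads the list to the required length without changing the
      intersection.\<close>
    obtain D Es where "Ds = D # Es" using D pol_pos[OF up.hyps] by (cases Ds) auto
    then show ?thesis using up.prems(1)[of "D # Ds"] D by auto
  qed
  from up.IH[OF this up.prems(2,3)] show ?case .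
next
  case (add m f g)
  then show ?case
    by (auto simp: distrib_right sum.distrib intro!: dvd_add add.IH(1) add.IH(2))
next
  case (scale m f c)
  have "l dvd (\<Sum>x\<in>P \<inter> \<Inter>(set Cs). f x * h x)" by (rule scale.IH[OF scale.prems])
  then show ?case by (simp add: mult.assoc flip: sum_distrib_left)
next
  case (mult m f k g)
  have "l dvd (\<Sum>x\<in>P \<inter> \<Inter>(set Ds). g x * h x)" if "length Ds = m + j" "set Ds \<subseteq> F" for Ds
    using that by (intro mult.IH(2)[of "m + j"] mult.prems(1)) (auto simp: ac_simps)
  from mult.IH(1)[OF this mult.prems(2,3)] show ?case by (simp add: mult.assoc)
qed

section \<open>Separating a point modulo a prime\<close>

text \<open>For \<open>m = 1\<close>, \<open>\<not> sep F p m T b\<close> says that \<open>b\<close> lies in the span of \<open>T\<close>, when a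
  point is read as the vector over the field with \<open>p\<close> elements of its incidences with \<open>F\<close>.\<close>

definition sep :: "'a set set \<Rightarrow> int \<Rightarrow> nat \<Rightarrow> 'a set \<Rightarrow> 'a \<Rightarrow> bool" where
  "sep F p m T b \<longleftrightarrow> (\<exists>f. pol F m f \<and> \<not> p dvd f b \<and> (\<forall>y\<in>T. p dvd f y))"

lemma sepI: "pol F m f \<Longrightarrow> \<not> p dvd f b \<Longrightarrow> (\<And>y. y \<in> T \<Longrightarrow> p dvd f y) \<Longrightarrow> sep F p m T b"
  unfolding sep_def by blast

lemma sepE:
  assumes "sep F p m T b"
  obtains f where "pol F m f" "\<not> p dvd f b" "\<And>y. y \<in> T \<Longrightarrow> p dvd f y"
  using assms unfolding sep_def by blast

lemma sep_mono: "sep F p m T b \<Longrightarrow> m \<le> k \<Longrightarrow> U \<subseteq> T \<Longrightarrow> sep F p k U b"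
  unfolding sep_def by (meson pol_mono subsetD)

text \<open>Multiply the two separating functions; primality keeps the product nonzero at
  \<open>b\<close>.\<close>

lemma sep_Un:
  assumes "prime p" "sep F p m T b" "sep F p k U b"
  shows "sep F p (m + k) (T \<union> U) b"
proof -
  obtain f where f: "pol F m f" "\<not> p dvd f b" "\<And>y. y \<in> T \<Longrightarrow> p dvd f y"
    using assms(2) by (rule sepE) blast
  obtain g where g: "pol F k g" "\<not> p dvd g b" "\<And>y. y \<in> U \<Longrightarrow> p dvd g y"
    using assms(3) by (rule sepE) blast
  show ?thesis
    using assms(1) f g by (intro sepI[OF pol.mult[OF f(1) g(1)]]) (auto simp: prime_dvd_mult_iff)
qed

lemma obtain_minimal_subset:
  assumes "finite S" "Q S"
  obtains J where "J \<subseteq> S" "Q J" "\<And>J'. J' \<subset> J \<Longrightarrow> \<not> Q J'"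
proof -
  have "\<exists>J. J \<subseteq> S \<and> Q J \<and> (\<forall>J'\<subset>J. \<not> Q J')"
    using assms
  proof (induction rule: finite_psubset_induct)
    case (psubset S)
    then show ?case by (cases "\<exists>J'\<subset>S. Q J'") (meson order.trans psubset_imp_subset, blast)
  qed
  then show thesis using that by blast
qed

text \<open>This is Steinitz exchange: take a minimal \<open>J\<close> whose span contains
  \<open>b\<close>. The form dual to some \<open>e\<close> in \<open>J\<close> cannot vanish at
  \<open>b\<close>, since otherwise \<open>b\<close> would lie outside the span of
  \<open>J\<close>.\<close>

lemma sep_exchange:
  assumes "prime p" "finite I"
    and indep: "\<And>e. e \<in> I \<Longrightarrow> sep F p 1 (I - {e}) e"
    and "sep F p 1 {} b" "\<not> sep F p 1 I b"
  shows "\<exists>e\<in>I. sep F p 1 (I - {e}) b"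
proof -
  obtain J where J: "J \<subseteq> I" "\<not> sep F p 1 J b" "\<And>J'. J' \<subset> J \<Longrightarrow> sep F p 1 J' b"
    using obtain_minimal_subset[OF assms(2), of "\<lambda>J. \<not> sep F p 1 J b"] assms(5) by metis
  obtain e where e: "e \<in> J" using J(2) assms(4) by (cases "J = {}") auto
  have "J - {e} \<subset> J" using e by auto
  then obtain g where g: "pol F 1 g" "\<not> p dvd g b" "\<And>y. y \<in> J - {e} \<Longrightarrow> p dvd g y"
    using J(3) unfolding sep_def by meson
  obtain f where f: "pol F 1 f" "\<not> p dvd f e" "\<And>y. y \<in> I - {e} \<Longrightarrow> p dvd f y"
    using indep J(1) e unfolding sep_def by (meson subsetD)
  have "\<not> p dvd f b"
  proof
    assume fb: "p dvd f b"
    have "sep F p 1 J b"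
    \<comment> \<open>The coefficients cancel the value at \<open>e\<close>, the only point of
      \<open>J\<close> where \<open>f\<close> or \<open>g\<close> may be nonzero modulo
      \<open>p\<close>.\<close>
    proof (rule sepI[OF pol_diff[OF g(1) f(1), of "f e" "g e"]])
      have "\<not> p dvd f e * g b" using \<open>prime p\<close> f(2) g(2) by (simp add: prime_dvd_mult_iff)
      then show "\<not> p dvd f e * g b - g e * f b"
        using fb by (metis dvd_diff_right_iff dvd_mult dvd_diff_commute dvd_diff_left_iff)
      show "p dvd f e * g y - g e * f y" if "y \<in> J" for y
        using that f(3)[of y] g(3)[of y] J(1) by (cases "y = e") auto
    qed
    with J(2) show False ..
  qed
  then have "sep F p 1 (I - {e}) b" using f by (intro sepI[OF f(1)])
  then show ?thesis using e J(1) by blast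
qed

section \<open>Counting traces of a family\<close>

definition trace :: "'a set set \<Rightarrow> 'a set \<Rightarrow> 'a set set" where
  "trace F S = (\<lambda>A. A \<inter> S) ` F"

text \<open>A trace on \<open>S\<close> is determined by its part in \<open>I\<close>: if two
  members agree on \<open>I\<close>, the difference of their indicators vanishes there, hence modulo
  \<open>p\<close> on all of \<open>S\<close>, and its values are only -1, 0 and 1.\<close>

lemma card_trace_le_spanning:
  assumes "p > 1" "finite I" "I \<subseteq> S" "\<And>b. b \<in> S \<Longrightarrow> \<not> sep F p 1 I b"
  shows "card (trace F S) \<le> 2 ^ card I"
proof -
  have *: "A \<inter> S \<subseteq> B \<inter> S" if "A \<in> F" "B \<in> F" "A \<inter> S \<inter> I = B \<inter> S \<inter> I" for A B
  proof safe
    fix x assume x: "x \<in> A" "x \<in> S"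
    have "sep F p 1 I x" if "x \<notin> B"
    proof (rule sepI[OF pol_diff[OF pol.ind[OF \<open>A \<in> F\<close>] pol.ind[OF \<open>B \<in> F\<close>], of 1 1]])
      show "\<not> p dvd 1 * of_bool (x \<in> A) - 1 * of_bool (x \<in> B)"
        using that x \<open>p > 1\<close> by simp
      show "p dvd 1 * of_bool (y \<in> A) - 1 * of_bool (y \<in> B)" if "y \<in> I" for y
      proof -
        have "y \<in> A \<longleftrightarrow> y \<in> B" using \<open>A \<inter> S \<inter> I = _\<close> that \<open>I \<subseteq> S\<close> by blast
        then show ?thesis by simp
      qed
    qed
    then show "x \<in> B" using assms(4) x by blast
  qed
  have "inj_on (\<lambda>A. A \<inter> I) (trace F S)"
    unfolding trace_def by (rule inj_onI) (use * in blast)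
  moreover have "(\<lambda>A. A \<inter> I) ` trace F S \<subseteq> Pow I" by auto
  ultimately have "card (trace F S) \<le> card (Pow I)"
    using \<open>finite I\<close> by (meson card_inj_on_le finite_Pow_iff)
  then show ?thesis using \<open>finite I\<close> by (simp add: card_Pow)
qed

lemma card_trace_Un_le:
  assumes "finite F"
  shows "card (trace F (S \<union> T)) \<le> card (trace F S) * card (trace F T)"
proof -
  let ?h = "\<lambda>A. (A \<inter> S, A \<inter> T)"
  have "inj_on ?h (trace F (S \<union> T))"
    by (rule inj_onI) (auto simp: trace_def)
  moreover have "?h ` trace F (S \<union> T) \<subseteq> trace F S \<times> trace F T"
    by (auto simp: trace_def)
  moreover have "finite (trace F S \<times> trace F T)"
    using assms by (auto simp: trace_def)
  ultimately have "card (trace F (S \<union> T)) \<le> card (trace F S \<times> trace F T)"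
    by (rule card_inj_on_le)
  then show ?thesis by (simp add: card_cartesian_product)
qed

lemma card_trace_le:
  assumes "finite S" shows "card (trace F S) \<le> 2 ^ card S"
  using card_mono[of "Pow S" "trace F S"] assms by (auto simp: trace_def card_Pow)

lemma card_trace_UN_le:
  assumes "finite F" "finite Q" "\<And>p. p \<in> Q \<Longrightarrow> card (trace F (N p)) \<le> 2 ^ s p"
    and "finite S"
  shows "card (trace F (S \<union> (\<Union>p\<in>Q. N p))) \<le> 2 ^ (card S + (\<Sum>p\<in>Q. s p))"
  using assms(2,3)
proof (induction rule: finite_induct)
  case (insert q Q)
  have "S \<union> (\<Union>p\<in>insert q Q. N p) = (S \<union> (\<Union>p\<in>Q. N p)) \<union> N q" by auto
  then have "card (trace F (S \<union> (\<Union>p\<in>insert q Q. N p)))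
      \<le> card (trace F (S \<union> (\<Union>p\<in>Q. N p))) * card (trace F (N q))"
    using card_trace_Un_le[OF assms(1)] by metis
  also have "\<dots> \<le> 2 ^ (card S + (\<Sum>p\<in>Q. s p)) * 2 ^ s q"
    using insert by (intro mult_mono) auto
  finally show ?case using insert by (simp add: power_add ac_simps)
qed (use card_trace_le[OF assms(4)] in simp)

section \<open>Points that cannot be isolated modulo a prime\<close>

text \<open>\<open>P\<close> stands for representatives of the classes of points. For their
  incidence vectors, \<open>cover\<close> says nonzero and \<open>separate\<close> says pairwise
  distinct.\<close>

locale separating_family =
  fixes F :: "'a set set" and P :: "'a set"
  assumes finite_P: "finite P"
    and cover: "x \<in> P \<Longrightarrow> \<exists>A\<in>F. x \<in> A"
    and separate: "x \<in> P \<Longrightarrow> y \<in> P \<Longrightarrow> x \<noteq> y \<Longrightarrow> \<exists>A\<in>F. x \<in> A \<longleftrightarrow> y \<notin> A"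
begin

lemma sep_empty:
  assumes "prime p" "b \<in> P" shows "sep F p 1 {} b"
proof -
  obtain A where "A \<in> F" "b \<in> A" using cover assms(2) by blast
  then show ?thesis
    using prime_gt_1_int[OF assms(1)] by (intro sepI[OF pol.ind[of A]]) auto
qed

text \<open>Distinct nonzero vectors with entries 0 and 1 are not proportional, so a single linear
  form suffices.\<close>

lemma sep_point:
  assumes "prime p" "b \<in> P" "e \<in> P" "b \<noteq> e" shows "sep F p 1 {e} b"
proof -
  have p: "\<not> p dvd 1" using assms(1) not_prime_unit by blast
  obtain A where A: "A \<in> F" "b \<in> A \<longleftrightarrow> e \<notin> A" using separate assms by blast
  obtain C where C: "C \<in> F" "b \<in> C" using cover assms by blast
  show ?thesis
  proof (cases "b \<in> A")
    case True
    then show ?thesis using A p by (intro sepI[OF pol.ind[of A]]) auto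
  next
    case F: False
    show ?thesis
    proof (cases "e \<in> C")
      case False
      then show ?thesis using C p by (intro sepI[OF pol.ind[of C]]) auto
    next
      case True
      then show ?thesis using A C F p
        by (intro sepI[OF pol_diff[OF pol.ind[OF C(1)] pol.ind[OF A(1)], of 1 1]]) auto
    qed
  qed
qed

text \<open>If \<open>b\<close> lies in the span of \<open>I\<close> but not in \<open>I\<close>,
  exchange yields \<open>e\<close> such that one form handles \<open>I - {e}\<close>; a second one
  handles \<open>e\<close>.\<close>

lemma sep_independent:
  assumes "prime p" "I \<subseteq> P" "b \<in> P"
    and indep: "\<And>e. e \<in> I \<Longrightarrow> sep F p 1 (I - {e}) e"
  shows "sep F p 2 (I - {b}) b"
proof (cases "b \<in> I \<or> sep F p 1 I b")
  case True
  then have "sep F p 1 (I - {b}) b"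
    using indep sep_mono[of F p 1 I b 1 "I - {b}"] by auto
  then show ?thesis by (rule sep_mono) auto
next
  case False
  have "finite I" using assms(2) finite_P by (rule finite_subset)
  then obtain e where e: "e \<in> I" "sep F p 1 (I - {e}) b"
    using sep_exchange[OF assms(1) _ indep sep_empty[OF assms(1,3)]] False by auto
  have "sep F p 1 {e} b" using sep_point assms e False by blast
  with e(2) have "sep F p (1 + 1) (I - {e} \<union> {e}) b" by (rule sep_Un[OF assms(1)])
  then show ?thesis by (rule sep_mono) auto
qed

text \<open>Bases are peeled off \<open>R\<close> greedily. As long as what is left of \<open>R\<close> still spans \<open>S\<close>, a basis
  of it has at least \<open>s\<close> elements and two linear forms per basis suffice; once it no longer
  spans, a single linear form takes care of the whole rest.\<close>

lemma sep_or_large: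
  assumes "prime p" "S \<subseteq> P"
    and s: "\<And>I. I \<subseteq> S \<Longrightarrow> (\<And>b. b \<in> S \<Longrightarrow> \<not> sep F p 1 I b) \<Longrightarrow> s \<le> card I"
    and "R \<subseteq> S"
  shows "k * s \<le> card R \<or> (\<exists>b\<in>S. sep F p (2 * k) (R - {b}) b)"
  using assms(4)
proof (induction k arbitrary: R)
  case (Suc k)
  show ?case
  proof (cases "\<exists>b\<in>S. sep F p 1 R b")
    case True
    then obtain b where b: "b \<in> S" "sep F p 1 R b" ..
    from b(2) have "sep F p (2 * Suc k) (R - {b}) b" by (rule sep_mono) auto
    with b(1) show ?thesis by blast
  next
    case span: False
    have "finite R" using Suc.prems assms(2) finite_P by (meson finite_subset)
    then obtain I where I: "I \<subseteq> R" "\<And>b. b \<in> S \<Longrightarrow> \<not> sep F p 1 I b"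
      and min: "\<And>J. J \<subset> I \<Longrightarrow> \<exists>b\<in>S. sep F p 1 J b"
      using obtain_minimal_subset[of R "\<lambda>I. \<forall>b\<in>S. \<not> sep F p 1 I b"] span by metis
    have sI: "s \<le> card I" using s I Suc.prems by blast
    have indep: "sep F p 1 (I - {e}) e" if "e \<in> I" for e
    proof -
      have "I - {e} \<subset> I" using that by auto
      from min[OF this] obtain b where b: "b \<in> S" "sep F p 1 (I - {e}) b" ..
      obtain f where f: "pol F 1 f" "\<not> p dvd f b" "\<And>y. y \<in> I - {e} \<Longrightarrow> p dvd f y"
        using b(2) by (rule sepE) blast
      \<comment> \<open>Minimality of a spanning set forces independence: if \<open>f\<close> also
        vanished at \<open>e\<close>, then \<open>I\<close> would fail to span
        \<open>b\<close>.\<close>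
      have "\<not> p dvd f e"
      proof
        assume "p dvd f e"
        then have "p dvd f y" if "y \<in> I" for y using f(3)[of y] that by (cases "y = e") auto
        with f(1,2) have "sep F p 1 I b" by (rule sepI)
        with I(2) b(1) show False by blast
      qed
      then show ?thesis using f by (intro sepI[OF f(1)])
    qed
    have RI: "card (R - I) + card I = card R"
      using I(1) \<open>finite R\<close> by (metis card_Diff_subset card_mono finite_subset le_add_diff_inverse2)
    consider "k * s \<le> card (R - I)" | b where "b \<in> S" "sep F p (2 * k) (R - I - {b}) b"
      using Suc.IH[of "R - I"] Suc.prems by blast
    then show ?thesis
    proof cases
      case 1
      then show ?thesis using RI sI by simp
    next
      case 2
      have "sep F p 2 (I - {b}) b"
        using sep_independent[OF assms(1) _ _ indep] I(1) Suc.prems assms(2) 2(1) by blast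
      from sep_Un[OF assms(1) 2(2) this]
      have "sep F p (2 * Suc k) (R - {b}) b" by (rule sep_mono) auto
      then show ?thesis using 2(1) by blast
    qed
  qed
qed simp

definition bad :: "int \<Rightarrow> nat \<Rightarrow> 'a set" where
  "bad p m = {x \<in> P. \<not> sep F p m (P - {x}) x}"

text \<open>The good points cause no harm, since their separating functions can be used for elimination.\<close>

lemma not_sep_bad:
  assumes "prime p" "b \<in> bad p m" shows "\<not> sep F p m (bad p m - {b}) b"
proof
  assume *: "sep F p m (bad p m - {b}) b"
  \<comment> \<open>Good points are added one at a time, until \<open>b\<close> is separated from
    all of \<open>P - {b}\<close>.\<close>
  have "sep F p m (bad p m - {b} \<union> Y) b" if "Y \<subseteq> P - bad p m" for Y
    using finite_subset[OF that finite_Diff[OF finite_P]] that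
  proof (induction rule: finite_induct)
    case (insert y Y)
    have "sep F p m (bad p m - {b} \<union> Y) b" "sep F p m (P - {y}) y"
      using insert.IH insert.prems by (auto simp: bad_def)
    obtain f where f: "pol F m f" "\<not> p dvd f b" "\<And>z. z \<in> bad p m - {b} \<union> Y \<Longrightarrow> p dvd f z"
      using \<open>sep F p m (bad p m - {b} \<union> Y) b\<close> by (rule sepE) blast
    obtain g where g: "pol F m g" "\<not> p dvd g y" "\<And>z. z \<in> P - {y} \<Longrightarrow> p dvd g z"
      using \<open>sep F p m (P - {y}) y\<close> by (rule sepE) blast
    have bP: "b \<in> P" "b \<noteq> y" "bad p m \<subseteq> P" using assms(2) insert.prems by (auto simp: bad_def)
    show ?case
    \<comment> \<open>The combination cancels the value at \<open>y\<close>. Elsewhere on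
      \<open>P\<close> it is \<open>f\<close> times the unit \<open>g y\<close> modulo
      \<open>p\<close>, because \<open>g\<close> vanishes there.\<close>
    proof (rule sepI[OF pol_diff[OF f(1) g(1), of "g y" "f y"]])
      have "\<not> p dvd g y * f b" using assms(1) f(2) g(2) by (simp add: prime_dvd_mult_iff)
      moreover have "p dvd f y * g b" using g(3)[of b] bP by simp
      ultimately show "\<not> p dvd g y * f b - f y * g b" by (metis diff_add_cancel dvd_add)
      show "p dvd g y * f z - f y * g z" if "z \<in> bad p m - {b} \<union> insert y Y" for z
        using that f(3)[of z] g(3)[of z] bP insert.prems by (cases "z = y") auto
    qed
  qed (use * in simp)
  from this[of "P - bad p m"] have "sep F p m (P - {b}) b"
    by (rule sep_mono) (auto)
  with assms(2) show False by (simp add: bad_def)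
qed

text \<open>Take for \<open>s\<close> the least size of a subset spanning the bad points. The second
  alternative of \<open>sep_or_large\<close> is ruled out by \<open>not_sep_bad\<close>, and the
  empty set spans no point of \<open>P\<close>.\<close>

lemma bad_bound:
  assumes "prime p"
  obtains s where "card (trace F (bad p (2 * K))) \<le> 2 ^ s" "K * s \<le> card (bad p (2 * K))"
    "bad p (2 * K) \<noteq> {} \<longrightarrow> s \<ge> 1"
proof -
  define S where "S = bad p (2 * K)"
  have S: "S \<subseteq> P" "finite S" using finite_P by (auto simp: S_def bad_def)
  let ?sp = "\<lambda>I. I \<subseteq> S \<and> (\<forall>b\<in>S. \<not> sep F p 1 I b)"
  have "?sp S" unfolding sep_def by auto
  then obtain I where I: "?sp I" "\<And>J. ?sp J \<Longrightarrow> card I \<le> card J"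
    using ex_has_least_nat[of ?sp S card] by blast
  have "finite I" using I S finite_subset by blast
  show thesis
  proof (rule that[of "card I"])
    show "card (trace F (bad p (2 * K))) \<le> 2 ^ card I"
      unfolding S_def[symmetric] using I(1) \<open>finite I\<close> prime_gt_1_int[OF assms]
      by (intro card_trace_le_spanning[of p]) auto
    show "K * card I \<le> card (bad p (2 * K))"
      using sep_or_large[OF assms S(1), of "card I" S K] I(2) not_sep_bad[OF assms]
      unfolding S_def by blast
    show "bad p (2 * K) \<noteq> {} \<longrightarrow> card I \<ge> 1"
      unfolding S_def[symmetric] using I(1) \<open>finite I\<close> sep_empty[OF assms] S(1)
      by (cases "I = {}") (auto simp: Suc_le_eq card_gt_0_iff)
  qed
qed

end

section \<open>Divisibility of weights, and the loss caused by bad points\<close>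

text \<open>This keeps the degree of \<open>f ^ a\<close> within \<open>4 * l\<^sup>2\<close>. Every
  prime power in the factorization of \<open>l\<close> is at least 2, so \<open>l\<close> is at
  least 2 to the power \<open>a + c - 1\<close>, where \<open>a\<close> is the multiplicity of
  \<open>p\<close> and \<open>c\<close> the number of prime factors.\<close>

lemma card_prime_factors_mult_multiplicity_le:
  fixes l :: nat
  assumes "l > 0" "p \<in> prime_factors l"
  shows "card (prime_factors l) * multiplicity p l \<le> l"
proof -
  let ?Q = "prime_factors l - {p}" and ?a = "multiplicity p l"
  have "l = (\<Prod>q\<in>prime_factors l. q ^ multiplicity q l)"
    using assms by (simp add: prime_factorization_nat)
  also have "\<dots> = p ^ ?a * (\<Prod>q\<in>?Q. q ^ multiplicity q l)"
    using assms(2) by (simp add: prod.remove)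
  finally have l: "l = p ^ ?a * (\<Prod>q\<in>?Q. q ^ multiplicity q l)" .
  have "2 \<le> q ^ multiplicity q l" if "q \<in> prime_factors l" for q
  proof -
    have "q ^ 1 \<le> q ^ multiplicity q l"
      using that by (intro power_increasing) (auto simp: prime_factors_multiplicity Suc_le_eq prime_gt_0_nat)
    then show ?thesis using that prime_ge_2_nat[of q] by (auto simp: in_prime_factors_iff)
  qed
  then have "(\<Prod>q\<in>?Q. 2) \<le> (\<Prod>q\<in>?Q. q ^ multiplicity q l)"
    by (intro prod_mono) auto
  moreover have "2 ^ ?a \<le> p ^ ?a"
    using assms(2) by (intro power_mono) (auto simp: in_prime_factors_iff prime_ge_2_nat)
  ultimately have "2 ^ ?a * 2 ^ card ?Q \<le> l"
    by (subst l) (auto intro: mult_mono)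
  moreover have "?a > 0" using assms(2) by (auto simp: prime_factors_multiplicity)
  then obtain a where a: "?a = Suc a" by (cases ?a) auto
  have "card (prime_factors l) = Suc (card ?Q)"
    using assms(2) by (meson card.remove finite_set_mset)
  moreover have "Suc (card ?Q) * Suc a \<le> 2 ^ Suc (card ?Q) * 2 ^ a"
    using less_exp[of "Suc (card ?Q)"] less_exp[of a] by (intro mult_mono) linarith+
  ultimately show ?thesis using a by (simp add: ac_simps)
qed

context separating_family
begin

lemma dvd_weight:
  fixes w :: "'a \<Rightarrow> nat"
  assumes "l > 0"
    and div: "\<And>Cs. length Cs = M \<Longrightarrow> set Cs \<subseteq> F \<Longrightarrow> l dvd (\<Sum>x\<in>P \<inter> \<Inter>(set Cs). w x)"
    and "x \<in> P"
    and good: "\<And>p. p \<in> prime_factors l \<Longrightarrow> x \<notin> bad (int p) m"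
    and M: "\<And>p. p \<in> prime_factors l \<Longrightarrow> m * multiplicity p l \<le> M"
  shows "l dvd w x"
proof (cases "w x = 0")
  case False
  show ?thesis
  proof (rule multiplicity_le_imp_dvd)
    fix p :: nat assume p: "prime p"
    let ?a = "multiplicity p l"
    show "?a \<le> multiplicity p (w x)"
    proof (cases "p dvd l")
      case True
      then have pl: "p \<in> prime_factors l" using p assms(1) by (auto simp: in_prime_factors_iff)
      then have a: "?a > 0" by (auto simp: prime_factors_multiplicity)
      obtain f where f: "pol F m f" "\<not> int p dvd f x" "\<And>y. y \<in> P - {x} \<Longrightarrow> int p dvd f y"
        using good[OF pl] \<open>x \<in> P\<close> unfolding bad_def sep_def by blast
      have "pol F M (\<lambda>x. f x ^ ?a)" using pol_mono[OF pol_power[OF f(1) a] M[OF pl]] .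
      moreover have "int l dvd (\<Sum>x\<in>P \<inter> \<Inter>(set Cs). int (w x))"
        if "length Cs = M + 0" "set Cs \<subseteq> F" for Cs
        using div[of Cs] that by (metis add_0_right of_nat_dvd_iff of_nat_sum)
      \<comment> \<open>The empty list intersects to \<open>UNIV\<close>, so the sum runs over all
        of \<open>P\<close>.\<close>
      ultimately have "int l dvd (\<Sum>x\<in>P \<inter> \<Inter>(set []). f x ^ ?a * int (w x))"
        using finite_P by (intro dvd_sum_pol[where j = 0]) auto
      moreover have "int p ^ ?a dvd int l"
        by (metis multiplicity_dvd of_nat_dvd_iff of_nat_power)
      ultimately have "int p ^ ?a dvd (\<Sum>x\<in>P. f x ^ ?a * int (w x))"
        using dvd_trans by fastforce
      also have "(\<Sum>x\<in>P. f x ^ ?a * int (w x))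
          = f x ^ ?a * int (w x) + (\<Sum>x\<in>P - {x}. f x ^ ?a * int (w x))"
        using finite_P \<open>x \<in> P\<close> by (rule sum.remove)
      finally have "int p ^ ?a dvd f x ^ ?a * int (w x) + (\<Sum>x\<in>P - {x}. f x ^ ?a * int (w x))" .
      \<comment> \<open>Away from \<open>x\<close> the values of \<open>f\<close> are divisible by
        \<open>p\<close>, so their \<open>?a\<close>-th powers vanish modulo
        \<open>p ^ ?a\<close>.\<close>
      moreover have "int p ^ ?a dvd (\<Sum>x\<in>P - {x}. f x ^ ?a * int (w x))"
        using f(3) by (intro dvd_sum dvd_mult2 dvd_power_same)
      ultimately have "int p ^ ?a dvd f x ^ ?a * int (w x)"
        by (simp add: dvd_add_left_iff)
      moreover have "coprime (int p ^ ?a) (f x ^ ?a)"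
        using p f(2) by (simp add: prime_imp_coprime)
      ultimately have "int p ^ ?a dvd int (w x)" by (simp add: coprime_dvd_mult_right_iff)
      then have "p ^ ?a dvd w x" by (metis of_nat_dvd_iff of_nat_power)
      then show ?thesis using False p by (intro multiplicity_geI) (auto simp: not_prime_unit)
    qed (simp add: not_dvd_imp_multiplicity_0)
  qed (use assms(1) False in auto)
qed simp

text \<open>Each good point uses weight at least \<open>l\<close> and contributes at most a factor 2
  to the number of traces. Bad points weigh at least 1 each, but are so numerous compared with the
  exponents \<open>s p\<close> that they leave weight \<open>l\<close> to spare.\<close>

lemma dvd_weight_or_small:
  fixes w :: "'a \<Rightarrow> nat"
  assumes "l > 0" "finite F" "inj_on (\<lambda>A. A \<inter> P) F"
    and w: "\<And>x. x \<in> P \<Longrightarrow> w x > 0" "(\<Sum>x\<in>P. w x) \<le> n"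
    and div: "\<And>Cs. length Cs = 4 * l\<^sup>2 \<Longrightarrow> set Cs \<subseteq> F \<Longrightarrow> l dvd (\<Sum>x\<in>P \<inter> \<Inter>(set Cs). w x)"
  shows "(\<forall>x\<in>P. l dvd w x) \<or> n div l > 0 \<and> card F \<le> 2 ^ (n div l - 1)"
proof -
  define Q K where "Q = prime_factors l" and "K = 2 * l * card Q"
  define N U where "N p = bad (int p) (2 * K)" and "U = (\<Union>p\<in>Q. N p)" for p
  have Q: "finite Q" "\<And>p. p \<in> Q \<Longrightarrow> prime (int p)" by (auto simp: Q_def)
  have "finite U" "U \<subseteq> P" using finite_P by (auto simp: U_def N_def bad_def intro: finite_subset)
  have M: "2 * K * multiplicity p l \<le> 4 * l\<^sup>2" if "p \<in> Q" for p
    using card_prime_factors_mult_multiplicity_le[of l p] that assms(1)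
    by (simp add: K_def Q_def power2_eq_square)
  have dvd: "l dvd w x" if "x \<in> P - U" for x
    using assms(1) div _ _ M
    by (rule dvd_weight[where M = "4 * l\<^sup>2" and m = "2 * K"]) (use that in \<open>auto simp: Q_def U_def N_def\<close>)
  show ?thesis
  proof (cases "U = {}")
    case False
    have "\<exists>s. card (trace F (N p)) \<le> 2 ^ s \<and> K * s \<le> card (N p) \<and> (N p \<noteq> {} \<longrightarrow> s \<ge> 1)"
      if "p \<in> Q" for p
      using bad_bound[OF Q(2)[OF that], of K] unfolding N_def by blast
    then obtain s where s: "\<And>p. p \<in> Q \<Longrightarrow> card (trace F (N p)) \<le> 2 ^ s p"
      "\<And>p. p \<in> Q \<Longrightarrow> K * s p \<le> card (N p)" "\<And>p. p \<in> Q \<Longrightarrow> N p \<noteq> {} \<Longrightarrow> s p \<ge> 1"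
      by metis
    define e where "e = card (P - U) + (\<Sum>p\<in>Q. s p)"
    have "card F = card (trace F P)" using assms(3) by (simp add: trace_def card_image)
    also have "\<dots> = card (trace F (P - U \<union> (\<Union>p\<in>Q. N p)))"
      using \<open>U \<subseteq> P\<close> unfolding U_def[symmetric] by (simp add: Un_absorb2)
    also have "\<dots> \<le> 2 ^ e"
      unfolding e_def using assms(2) Q(1) s(1) finite_P by (intro card_trace_UN_le) auto
    finally have F: "card F \<le> 2 ^ e" .
    obtain p where p: "p \<in> Q" "N p \<noteq> {}" using False by (auto simp: U_def)
    have NU: "card (N p) \<le> card U" if "p \<in> Q" for p
      using that \<open>finite U\<close> by (intro card_mono) (auto simp: U_def)
    have cQ: "card Q > 0" using p(1) Q(1) by (auto simp: card_gt_0_iff)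
    have "2 * l * (1 * 1) \<le> 2 * l * (card Q * s p)"
      using cQ s(3)[OF p] by (intro mult_le_mono) auto
    then have U1: "2 * l \<le> card U" using s(2)[OF p(1)] NU[OF p(1)] by (simp add: K_def ac_simps)
    \<comment> \<open>The sets \<open>N p\<close> may overlap, so each is bounded by the whole of
      \<open>U\<close>; the factor \<open>card Q\<close> in \<open>K\<close> pays for this.\<close>
    have "K * (\<Sum>p\<in>Q. s p) \<le> (\<Sum>p\<in>Q. card U)"
      unfolding sum_distrib_left using s(2) NU by (intro sum_mono) (meson order.trans)
    then have "card Q * (2 * l * (\<Sum>p\<in>Q. s p)) \<le> card Q * card U"
      by (simp add: K_def ac_simps)
    then have U2: "2 * l * (\<Sum>p\<in>Q. s p) \<le> card U" using cQ by simp
    have "l * card (P - U) \<le> (\<Sum>x\<in>P - U. w x)"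
      using sum_mono[of "P - U" "\<lambda>_. l" w] dvd w(1) by (simp add: dvd_imp_le mult.commute)
    moreover have "card U \<le> (\<Sum>x\<in>U. w x)"
      using sum_mono[of U "\<lambda>_. 1" w] w(1) \<open>U \<subseteq> P\<close> by (auto simp: Suc_le_eq)
    moreover have "(\<Sum>x\<in>P. w x) = (\<Sum>x\<in>P - U. w x) + (\<Sum>x\<in>U. w x)"
      using \<open>U \<subseteq> P\<close> finite_P by (rule sum.subset_diff)
    ultimately have "l * card (P - U) + card U \<le> n" using w(2) by linarith
    \<comment> \<open>The mean of \<open>U1\<close> and \<open>U2\<close> bounds
      \<open>card U\<close> below by \<open>l\<close> times one more than the sum of the
      \<open>s p\<close>; the extra one is the saved factor 2.\<close>
    then have "(e + 1) * l \<le> n" using U1 U2 by (simp add: e_def algebra_simps)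
    then have "e + 1 \<le> n div l" using assms(1) by (simp add: less_eq_div_iff_mult_less_eq)
    moreover from this have "(2::nat) ^ e \<le> 2 ^ (n div l - 1)" by (intro power_increasing) auto
    ultimately show ?thesis using F by (intro disjI2) linarith
  qed (use dvd in auto)
qed

end

section \<open>From classes of points to atoms\<close>

lemma partition_into_blocks:
  assumes "finite S" "l dvd card S" "l > 0"
  shows "\<exists>B. pairwise disjnt B \<and> \<Union>B = S \<and> (\<forall>b\<in>B. card b = l)"
proof -
  obtain k where "card S = k * l" using assms(2) by (auto simp: dvd_def mult.commute)
  then show ?thesis using assms(1)
  proof (induction k arbitrary: S)
    case 0
    then show ?case by (intro exI[of _ "{}"]) auto
  next
    case (Suc k)
    then obtain T where T: "T \<subseteq> S" "card T = l" using obtain_subset_with_card_n[of l S] by auto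
    then have "card (S - T) = k * l" using Suc.prems by (simp add: card_Diff_subset finite_subset)
    then obtain B where "pairwise disjnt B" "\<Union>B = S - T" "\<forall>b\<in>B. card b = l"
      using Suc.IH[of "S - T"] Suc.prems(2) by auto
    moreover from this have "disjnt T b" "disjnt b T" if "b \<in> B" for b
      using that by (auto simp: disjnt_def)
    ultimately show ?case using T
      by (intro exI[of _ "insert T B"]) (auto simp: pairwise_insert)
  qed
qed

theorem theorem1p4:
  fixes l n :: nat and F :: "nat set set"
  assumes "l > 0" and "n > 0"
    and "F \<subseteq> Pow {1..n}"
    and "kwise_divisible (4 * l^2) l F"
  shows "card F \<le> 2 ^ (n div l) \<and>
    (real (card F) > 2 powi (int (n div l) - 1) \<longrightarrow>
      (\<exists>B G. atomic_family {1..n} B G \<and> (\<forall>b\<in>B. card b = l) \<and> F \<subseteq> G))"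
proof -
  \<comment> \<open>Points in no member are dropped, as \<open>cover\<close> requires. The least
    element of a class serves as its representative, and \<open>C y\<close> is the class represented
    by \<open>y\<close>.\<close>
  define X where "X = \<Union>F"
  define cls where "cls x = {y \<in> X. \<forall>A\<in>F. x \<in> A \<longleftrightarrow> y \<in> A}" for x
  define r where "r x = Min (cls x)" for x
  define P where "P = r ` X"
  define C where "C y = {x \<in> X. r x = y}" for y
  have X: "X \<subseteq> {1..n}" "finite X" using assms(3) finite_subset[of X "{1..n}"] by (auto simp: X_def)
  have "finite F" using assms(3) finite_subset by blast
  have "finite P" using X by (simp add: P_def)
  have r: "r x \<in> X" "\<And>A. A \<in> F \<Longrightarrow> r x \<in> A \<longleftrightarrow> x \<in> A" if "x \<in> X" for x
  proof -
    have "r x \<in> cls x"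
      unfolding r_def using X(2) that by (intro Min_in) (auto simp: cls_def)
    then show "r x \<in> X" "\<And>A. A \<in> F \<Longrightarrow> r x \<in> A \<longleftrightarrow> x \<in> A" by (auto simp: cls_def)
  qed
  have r_eq: "r x = r y" if "\<And>A. A \<in> F \<Longrightarrow> x \<in> A \<longleftrightarrow> y \<in> A" for x y
    using that by (simp add: r_def cls_def)
  have sub: "A \<subseteq> X" if "A \<in> F" for A using that by (auto simp: X_def)
  have C_sub: "C y \<subseteq> A" if "y \<in> A" "A \<in> F" for y A
    using that r(2) by (auto simp: C_def)
  interpret separating_family F P
  proof
    show "\<exists>A\<in>F. x \<in> A" if "x \<in> P" for x
      using that r(1) by (auto simp: P_def X_def)
    show "\<exists>A\<in>F. x \<in> A \<longleftrightarrow> y \<notin> A" if "x \<in> P" "y \<in> P" "x \<noteq> y" for x y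
    proof (rule ccontr)
      obtain u v where uv: "x = r u" "y = r v" "u \<in> X" "v \<in> X" using \<open>x \<in> P\<close> \<open>y \<in> P\<close> by (auto simp: P_def)
      assume "\<not> (\<exists>A\<in>F. x \<in> A \<longleftrightarrow> y \<notin> A)"
      then have "r u = r v" using uv r(2) by (intro r_eq) blast
      with uv \<open>x \<noteq> y\<close> show False by simp
    qed
  qed fact
  have card_C: "card Y = (\<Sum>y\<in>P \<inter> Y. card (C y))" if "Y \<subseteq> X" "\<And>x. x \<in> X \<Longrightarrow> r x \<in> Y \<longleftrightarrow> x \<in> Y" for Y
  proof -
    have "Y = (\<Union>y\<in>P \<inter> Y. C y)"
    proof
      show "Y \<subseteq> (\<Union>y\<in>P \<inter> Y. C y)" using that by (auto simp: C_def P_def)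
      show "(\<Union>y\<in>P \<inter> Y. C y) \<subseteq> Y" using that(2) unfolding C_def by blast
    qed
    also have "card \<dots> = (\<Sum>y\<in>P \<inter> Y. card (C y))"
      using X(2) \<open>finite P\<close> by (intro card_UN_disjoint) (auto simp: C_def)
    finally show ?thesis .
  qed
  have inj: "inj_on (\<lambda>A. A \<inter> P) F"
  proof (rule inj_onI)
    fix A B assume AB: "A \<in> F" "B \<in> F" "A \<inter> P = B \<inter> P"
    have "x \<in> A \<longleftrightarrow> x \<in> B" if "x \<in> X" for x
    proof -
      have "r x \<in> P" using that by (simp add: P_def)
      then show ?thesis using AB r(2)[OF that] by blast
    qed
    then show "A = B" using sub AB(1,2) by blast
  qed
  have C_pos: "card (C y) > 0" if "y \<in> P" for y
    using that X(2) by (auto simp: P_def C_def card_gt_0_iff)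
  have "card X = (\<Sum>y\<in>P \<inter> X. card (C y))" using r(1) by (intro card_C) auto
  moreover have "P \<inter> X = P" using r(1) by (auto simp: P_def)
  moreover have "card X \<le> n" using card_mono[OF _ X(1)] by simp
  ultimately have C_sum: "(\<Sum>y\<in>P. card (C y)) \<le> n" by simp
  have div: "l dvd (\<Sum>x\<in>P \<inter> \<Inter>(set Cs). card (C x))" if Cs: "length Cs = 4 * l\<^sup>2" "set Cs \<subseteq> F" for Cs
  proof -
    \<comment> \<open>\<open>kwise_divisible\<close> indexes members from 1, lists are indexed from
      0.\<close>
    have "set Cs = (\<lambda>i. Cs ! (i - 1)) ` {1..4 * l\<^sup>2}"
    proof -
      have "{1..4 * l\<^sup>2} = Suc ` {..<length Cs}" using Cs(1) by (simp add: image_Suc_lessThan)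
      then show ?thesis by (simp add: image_image set_conv_nth) auto
    qed
    then have "l dvd card (\<Inter>(set Cs))"
      using assms(4) Cs(2) unfolding kwise_divisible_def by (metis image_subset_iff)
    moreover have "Cs \<noteq> []" using Cs(1) assms(1) by auto
    then obtain D where "D \<in> set Cs" by (meson list.set_sel(1))
    then have "\<Inter>(set Cs) \<subseteq> X" using sub Cs(2) by blast
    then have "card (\<Inter>(set Cs)) = (\<Sum>x\<in>P \<inter> \<Inter>(set Cs). card (C x))"
      using r(2) Cs(2) by (intro card_C) blast+
    ultimately show ?thesis by simp
  qed
  have "(\<forall>y\<in>P. l dvd card (C y)) \<or> n div l > 0 \<and> card F \<le> 2 ^ (n div l - 1)"
    by (rule dvd_weight_or_small[OF assms(1) \<open>finite F\<close> inj C_pos C_sum div])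
  then consider "\<forall>y\<in>P. l dvd card (C y)" | "n div l > 0" "card F \<le> 2 ^ (n div l - 1)"
    by metis
  then show ?thesis
  proof cases
    case 1
    \<comment> \<open>Members are determined by their representatives, and each class has at least
      \<open>l\<close> points.\<close>
    have "card F \<le> 2 ^ card P"
      using card_trace_le[OF \<open>finite P\<close>, of F] inj by (simp add: trace_def card_image)
    moreover have "card P * l \<le> n"
      using sum_mono[of P "\<lambda>_. l" "\<lambda>y. card (C y)"] 1 C_pos C_sum by (force simp: dvd_imp_le)
    then have "card P \<le> n div l" using assms(1) by (simp add: less_eq_div_iff_mult_less_eq)
    then have "(2::nat) ^ card P \<le> 2 ^ (n div l)" by (intro power_increasing) auto
    ultimately have bound: "card F \<le> 2 ^ (n div l)" by linarith
    have "\<exists>D. pairwise disjnt D \<and> \<Union>D = C y \<and> (\<forall>b\<in>D. card b = l)" if "y \<in> P" for y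
      using that 1 X(2) assms(1) by (intro partition_into_blocks) (auto simp: C_def)
    then obtain D where D: "\<And>y. y \<in> P \<Longrightarrow> pairwise disjnt (D y)" "\<And>y. y \<in> P \<Longrightarrow> \<Union>(D y) = C y"
      "\<And>y b. y \<in> P \<Longrightarrow> b \<in> D y \<Longrightarrow> card b = l"
      by metis
    define B where "B = (\<Union>y\<in>P. D y)"
    have "pairwise disjnt B"
    proof (rule pairwiseI)
      fix b c assume "b \<in> B" "c \<in> B" "b \<noteq> c"
      then obtain y z where yz: "y \<in> P" "z \<in> P" "b \<in> D y" "c \<in> D z" by (auto simp: B_def)
      show "disjnt b c"
      proof (cases "y = z")
        case True
        then show ?thesis using D(1)[OF yz(1)] yz \<open>b \<noteq> c\<close> by (auto simp: pairwise_def)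
      next
        case False
        then have "disjnt (C y) (C z)" by (auto simp: C_def disjnt_def)
        moreover have "b \<subseteq> C y" "c \<subseteq> C z" using D(2) yz by auto
        ultimately show ?thesis by (meson disjnt_subset1 disjnt_subset2)
      qed
    qed
    moreover have "B \<subseteq> Pow {1..n}"
    proof -
      have "b \<subseteq> X" if "b \<in> B" for b using that D(2) by (force simp: B_def C_def)
      then show ?thesis using X(1) by blast
    qed
    moreover have "A \<in> {\<Union>S | S. S \<subseteq> B}" if "A \<in> F" for A
    proof -
      \<comment> \<open>A member is the union of the classes of its representatives, so the blocks
        of these classes make it up.\<close>
      have "\<Union>(\<Union>y\<in>P \<inter> A. D y) = (\<Union>y\<in>P \<inter> A. \<Union>(D y))" by blast
      also have "\<dots> = (\<Union>y\<in>P \<inter> A. C y)" using D(2) by simp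
      also have "\<dots> = A"
        using C_sub that sub[OF that] r(2) by (auto simp: P_def C_def)
      finally show ?thesis unfolding B_def by blast
    qed
    moreover have "\<forall>b\<in>B. card b = l" using D(3) by (auto simp: B_def)
    ultimately have "\<exists>B G. atomic_family {1..n} B G \<and> (\<forall>b\<in>B. card b = l) \<and> F \<subseteq> G"
      unfolding atomic_family_def by (intro exI[of _ B] exI[of _ "{\<Union>S | S. S \<subseteq> B}"]) (simp add: subset_iff)
    with bound show ?thesis by simp
  next
    case 2
    have "(2::nat) ^ (n div l - 1) \<le> 2 ^ (n div l)" by (intro power_increasing) auto
    with 2(2) have "card F \<le> 2 ^ (n div l)" by (rule order.trans)
    moreover have "real (card F) \<le> real (2 ^ (n div l - 1))" using 2(2) by (simp only: of_nat_le_iff)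
    \<comment> \<open>Since \<open>n div l\<close> is positive, truncated subtraction agrees with
      the integer exponent, and the premise of the second claim is contradicted.\<close>
    moreover have "int (n div l) - 1 = int (n div l - 1)" using 2(1) by simp
    then have "2 powi (int (n div l) - 1) = real (2 ^ (n div l - 1))"
      by (simp only: power_int_of_nat of_nat_power of_nat_numeral)
    ultimately show ?thesis by (metis not_le)
  qed
qed

end
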